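(* Let $K$ be a field, $n\ge 1$, $S=K[x_1,\ldots,x_n]$, and let $I\subset S$ be a graded ideal. Then there exists a linear function $f(k)=ak+b$ such that $\mathrm{sat}(I^k)\leq f(k)$ for all integers $k\geq 0$.
   Context: $S=K[x_1,\ldots,x_n]$ is standard graded with graded maximal ideal $\mathfrak{m}=(x_1,\ldots,x_n)$. For a graded ideal $J\subset S$, the saturation number $\mathrm{sat}(J)$ is the smallest integer $k\ge 0$ such that $J:\mathfrak{m}^{k+1}=J:\mathfrak{m}^k$. *)

theory Defs
  imports Complex_Main "HOL-Library.Poly_Mapping"
begin

(* K[x_1,...,x_n]: a polynomial is the finitely supported map from exponent vectors to
   coefficients, with the library's convolution product.  The variables are indexed by a finite
   type 'n, so n = CARD('n), and n >= 1 because types are nonempty. *)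
type_synonym ('n, 'k) mpoly = "('n \<Rightarrow>\<^sub>0 nat) \<Rightarrow>\<^sub>0 'k"

definition var :: "'n \<Rightarrow> ('n, 'k::comm_ring_1) mpoly" where
  "var i = Poly_Mapping.single (Poly_Mapping.single i 1) 1"

definition mdeg :: "('n::finite \<Rightarrow>\<^sub>0 nat) \<Rightarrow> nat" where
  "mdeg m = (\<Sum>i\<in>UNIV. Poly_Mapping.lookup m i)"

definition hom_component :: "nat \<Rightarrow> ('n::finite, 'k::comm_ring_1) mpoly \<Rightarrow> ('n, 'k) mpoly" where
  "hom_component d f =
     (\<Sum>m \<in> {m \<in> Poly_Mapping.keys f. mdeg m = d}.
        Poly_Mapping.single m (Poly_Mapping.lookup f m))"

(* A commutative ring is a module over itself; its ideals are the submodules, and the ideal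
   generated by a set is its span. *)
lemma module_times: "module ((*) :: 'a::comm_ring_1 \<Rightarrow> 'a \<Rightarrow> 'a)"
  by unfold_locales (simp_all add: algebra_simps)

abbreviation is_ideal :: "'a::comm_ring_1 set \<Rightarrow> bool" where
  "is_ideal \<equiv> module.subspace (*)"

abbreviation ideal_gen :: "'a::comm_ring_1 set \<Rightarrow> 'a set" where
  "ideal_gen \<equiv> module.span (*)"

definition ideal_mult :: "'a::comm_ring_1 set \<Rightarrow> 'a set \<Rightarrow> 'a set" where
  "ideal_mult I J = ideal_gen {a * b | a b. a \<in> I \<and> b \<in> J}"

primrec ideal_pow :: "'a::comm_ring_1 set \<Rightarrow> nat \<Rightarrow> 'a set" where
  "ideal_pow I 0 = UNIV"
| "ideal_pow I (Suc k) = ideal_mult I (ideal_pow I k)"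

definition colon :: "'a::comm_ring_1 set \<Rightarrow> 'a set \<Rightarrow> 'a set" where
  "colon J Q = {f. \<forall>g\<in>Q. f * g \<in> J}"

(* I is the direct sum of its intersections with the homogeneous parts of the ring. *)
definition graded_ideal :: "('n::finite, 'k::comm_ring_1) mpoly set \<Rightarrow> bool" where
  "graded_ideal I \<longleftrightarrow> is_ideal I \<and> (\<forall>f\<in>I. \<forall>d. hom_component d f \<in> I)"

definition max_ideal :: "('n::finite, 'k::comm_ring_1) mpoly set" where
  "max_ideal = ideal_gen (range var)"

(* The chain J : m^k is ascending, so over a field (where the ring is Noetherian) it becomes
   stationary and the minimum is attained. *)
definition sat :: "('n::finite, 'k::field) mpoly set \<Rightarrow> nat" where
  "sat J = (LEAST k. colon J (ideal_pow max_ideal (k + 1)) = colon J (ideal_pow max_ideal k))"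

end

theory Submission
  imports Defs "HOL-Computational_Algebra.Polynomial"
begin

text \<open>
  The Rees ring \<open>\<Oplus>\<^sub>k I\<^sup>k t\<^sup>k\<close> is Noetherian, being generated over \<open>K\<close> by the variables and by
  \<open>f t\<close> for finitely many generators \<open>f\<close> of \<open>I\<close>.  The elements \<open>\<Sum>\<^sub>k g\<^sub>k t\<^sup>k\<close> of it with
  \<open>g\<^sub>k \<mm>\<^sup>N \<subseteq> I\<^sup>k\<^sup>+\<^sup>1\<close> for all \<open>k\<close> form an ideal that increases with \<open>N\<close>, hence is constant from some
  \<open>N\<close> on.  So for every \<open>j\<close>, an element of \<open>I\<^sup>j\<close> that some power of \<open>\<mm>\<close> multiplies into
  \<open>I\<^sup>j\<^sup>+\<^sup>1\<close> is multiplied there by \<open>\<mm>\<^sup>N\<close> already.  Climbing from \<open>I\<^sup>0\<close> to \<open>I\<^sup>k\<close> in \<open>k\<close> steps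
  gives \<open>I\<^sup>k : \<mm>\<^sup>M \<subseteq> I\<^sup>k : \<mm>\<^sup>N\<^sup>k\<close> for every \<open>M\<close>, that is, \<open>sat (I\<^sup>k) \<le> N k\<close>.
\<close>

section \<open>Noetherian subrings\<close>

text \<open>Rings are carrier sets inside one ambient type, so that \<open>adjoin R u\<close> and
  the Rees ring are subsets rather than new types.\<close>

definition subring :: "'a::comm_ring_1 set \<Rightarrow> bool" where
  "subring R \<longleftrightarrow> 1 \<in> R \<and> (\<forall>a\<in>R. \<forall>b\<in>R. a - b \<in> R \<and> a * b \<in> R)"

definition ideal_of :: "'a::comm_ring_1 set \<Rightarrow> 'a set \<Rightarrow> bool" where
  "ideal_of R J \<longleftrightarrow> J \<subseteq> R \<and> 0 \<in> J \<and> (\<forall>a\<in>J. \<forall>b\<in>J. a + b \<in> J) \<and> (\<forall>r\<in>R. \<forall>a\<in>J. r * a \<in> J)"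

text \<open>The ascending chain condition is the definition, since it is what the proof applies to
  chains of ideals; finite generation is derived from it later for ideals of the whole ring.\<close>

definition noetherian :: "'a::comm_ring_1 set \<Rightarrow> bool" where
  "noetherian R \<longleftrightarrow> subring R \<and>
     (\<forall>J. (\<forall>i::nat. ideal_of R (J i)) \<and> mono J \<longrightarrow> (\<exists>N. \<forall>i\<ge>N. J i = J N))"

definition adjoin :: "'a::comm_ring_1 set \<Rightarrow> 'a \<Rightarrow> 'a set" where
  "adjoin R u = {\<Sum>i<k. c i * u ^ i | c (k::nat). \<forall>i. c i \<in> R}"

lemma subring_closed:
  assumes "subring R"
  shows "0 \<in> R" "1 \<in> R"
    and "a \<in> R \<Longrightarrow> b \<in> R \<Longrightarrow> a - b \<in> R"
    and "a \<in> R \<Longrightarrow> b \<in> R \<Longrightarrow> a * b \<in> R"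
    and "a \<in> R \<Longrightarrow> - a \<in> R"
    and "a \<in> R \<Longrightarrow> b \<in> R \<Longrightarrow> a + b \<in> R"
proof -
  show 1: "1 \<in> R" using assms by (simp add: subring_def)
  show diff: "a - b \<in> R" if "a \<in> R" "b \<in> R" for a b
    using assms that by (simp add: subring_def)
  show "a * b \<in> R" if "a \<in> R" "b \<in> R"
    using assms that by (simp add: subring_def)
  show 0: "0 \<in> R" using diff[OF 1 1] by simp
  show neg: "- a \<in> R" if "a \<in> R" for a using diff[OF 0 that] by simp
  show "a + b \<in> R" if "a \<in> R" "b \<in> R" using diff[OF that(1) neg[OF that(2)]] by simp
qed

lemma subring_power: "subring R \<Longrightarrow> a \<in> R \<Longrightarrow> a ^ n \<in> R"
  by (induction n) (auto intro: subring_closed)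

lemma subring_sum: "subring R \<Longrightarrow> (\<And>i. i \<in> A \<Longrightarrow> f i \<in> R) \<Longrightarrow> sum f A \<in> R"
  by (induction A rule: infinite_finite_induct) (auto intro: subring_closed)

lemma subring_prod: "subring R \<Longrightarrow> (\<And>i. i \<in> A \<Longrightarrow> f i \<in> R) \<Longrightarrow> prod f A \<in> R"
  by (induction A rule: infinite_finite_induct) (auto intro: subring_closed)

lemma ideal_of_closed:
  assumes "ideal_of R J"
  shows "a \<in> J \<Longrightarrow> a \<in> R" "0 \<in> J"
    and "a \<in> J \<Longrightarrow> b \<in> J \<Longrightarrow> a + b \<in> J"
    and "r \<in> R \<Longrightarrow> a \<in> J \<Longrightarrow> r * a \<in> J"
  using assms by (auto simp: ideal_of_def)

lemma ideal_of_diff: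
  assumes "subring R" "ideal_of R J" "a \<in> J" "b \<in> J"
  shows "a - b \<in> J"
proof -
  have "-1 * b \<in> J"
    using assms by (intro ideal_of_closed(4)) (auto intro: subring_closed)
  from ideal_of_closed(3)[OF assms(2,3) this] show ?thesis by simp
qed

lemma noetherian_subring: "noetherian R \<Longrightarrow> subring R"
  by (simp add: noetherian_def)

lemma noetherian_chain:
  fixes J :: "nat \<Rightarrow> 'a::comm_ring_1 set"
  assumes "noetherian R" "\<And>i. ideal_of R (J i)" "mono J"
  obtains N where "\<And>i. i \<ge> N \<Longrightarrow> J i = J N"
proof -
  have "\<exists>N. \<forall>i\<ge>N. J i = J N" using assms by (simp add: noetherian_def)
  then show thesis using that by blast
qed

text \<open>A field has only two ideals: a chain that reaches the whole field stays there, and any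
  other chain is constantly zero.\<close>

lemma noetherian_field: "noetherian (UNIV :: 'a::field set)"
proof -
  have triv: "J = {0} \<or> J = UNIV" if J: "ideal_of UNIV J" for J :: "'a set"
  proof (rule disjCI)
    assume "J \<noteq> UNIV"
    moreover have "b \<in> J" if "a \<in> J" "a \<noteq> 0" for a b
      using ideal_of_closed(4)[OF J _ that(1), of "b / a"] that(2) by simp
    ultimately show "J = {0}" using ideal_of_closed(2)[OF J] by blast
  qed
  have "\<exists>N. \<forall>i\<ge>N. J i = J N"
    if J: "\<forall>i. ideal_of UNIV (J i)" "mono J" for J :: "nat \<Rightarrow> 'a set"
  proof (cases "\<exists>N. J N = UNIV")
    case True
    then obtain N where "J N = UNIV" ..
    with J(2) have "\<forall>i\<ge>N. J i = J N" by (metis monoD top.extremum_uniqueI)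
    then show ?thesis ..
  next
    case False
    then show ?thesis using triv J(1) by metis
  qed
  then show ?thesis by (auto simp: noetherian_def subring_def)
qed

text \<open>Chains are pulled back along the homomorphism. This serves to embed a ring as the
  constants of a larger one.\<close>

lemma noetherian_image:
  fixes \<phi> :: "'a::comm_ring_1 \<Rightarrow> 'b::comm_ring_1"
  assumes noeth: "noetherian (UNIV :: 'a set)"
    and one: "\<phi> 1 = 1" and add: "\<And>a b. \<phi> (a + b) = \<phi> a + \<phi> b"
    and mult: "\<And>a b. \<phi> (a * b) = \<phi> a * \<phi> b"
  shows "noetherian (range \<phi>)"
proof -
  have zero: "\<phi> 0 = 0" using add[of 0 0] by simp
  have diff: "\<phi> (a - b) = \<phi> a - \<phi> b" for a b using add[of "a - b" b] by simp
  have "subring (range \<phi>)"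
    unfolding subring_def by (auto simp flip: one diff mult)
  moreover have "\<exists>N. \<forall>i\<ge>N. J i = J N"
    if J: "\<forall>i. ideal_of (range \<phi>) (J i)" "mono J" for J :: "nat \<Rightarrow> 'b set"
  proof -
    have "ideal_of UNIV (\<phi> -` J i)" for i
      using J(1)[rule_format, of i] by (auto simp: ideal_of_def zero add mult)
    moreover have "mono (\<lambda>i. \<phi> -` J i)" using J(2) by (auto simp: mono_def)
    ultimately obtain N where N: "\<And>i. i \<ge> N \<Longrightarrow> \<phi> -` J i = \<phi> -` J N"
      using noetherian_chain[OF noeth, of "\<lambda>i. \<phi> -` J i"] by blast
    \<comment> \<open>Nothing is lost by the pullback, because \<open>J i\<close> lies in the
      range.\<close>
    have "\<phi> ` (\<phi> -` J i) = J i" for i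
      using J(1)[rule_format, of i] by (auto simp: ideal_of_def)
    with N have "\<forall>i\<ge>N. J i = J N" by metis
    then show ?thesis ..
  qed
  ultimately show ?thesis by (auto simp: noetherian_def)
qed

section \<open>Hilbert's basis theorem\<close>

lemma adjoinI: "(\<And>i. c i \<in> R) \<Longrightarrow> (\<Sum>i<k. c i * u ^ i) \<in> adjoin R u"
  by (auto simp: adjoin_def)

lemma adjoin_base:
  assumes "subring R" "c \<in> R"
  shows "c \<in> adjoin R u"
  using adjoinI[of "\<lambda>_. c" R u 1] assms by simp

lemma adjoin_gen:
  assumes "subring R"
  shows "u \<in> adjoin R u"
  using adjoinI[of "\<lambda>i. if i = 1 then 1 else 0" R u 2] assms
  by (simp add: subring_closed numeral_2_eq_2)

lemma adjoin_add:
  assumes R: "subring R" and "p \<in> adjoin R u" "q \<in> adjoin R u"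
  shows "p + q \<in> adjoin R u"
proof -
  obtain c k d l where c: "\<forall>i. c i \<in> R" "p = (\<Sum>i<k. c i * u ^ i)"
    and d: "\<forall>i. d i \<in> R" "q = (\<Sum>i<l. d i * u ^ i)"
    using assms(2,3) by (auto simp: adjoin_def)
  \<comment> \<open>Coefficients beyond the summation bounds may be nonzero, so they are cut to 0
    before both sums are extended to a common length.\<close>
  define c' d' where "c' i = (if i < k then c i else 0)" and "d' i = (if i < l then d i else 0)" for i
  have "p = (\<Sum>i<max k l. c' i * u ^ i)" "q = (\<Sum>i<max k l. d' i * u ^ i)"
    unfolding c(2) d(2) by (rule sum.mono_neutral_cong_left; simp add: c'_def d'_def)+
  then have "p + q = (\<Sum>i<max k l. (c' i + d' i) * u ^ i)"
    by (simp add: sum.distrib distrib_right)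
  also have "\<dots> \<in> adjoin R u"
    using R c(1) d(1) by (intro adjoinI) (auto simp: c'_def d'_def intro: subring_closed)
  finally show ?thesis .
qed

lemma adjoin_smult:
  assumes R: "subring R" and "a \<in> R" "p \<in> adjoin R u"
  shows "a * p \<in> adjoin R u"
proof -
  obtain c k where c: "\<forall>i. c i \<in> R" "p = (\<Sum>i<k. c i * u ^ i)"
    using assms(3) by (auto simp: adjoin_def)
  have "a * p = (\<Sum>i<k. (a * c i) * u ^ i)"
    by (simp add: c(2) sum_distrib_left mult.assoc)
  with c(1) R assms(2) show ?thesis by (auto intro!: adjoinI intro: subring_closed)
qed

lemma adjoin_shift:
  assumes R: "subring R" and "p \<in> adjoin R u"
  shows "p * u ^ n \<in> adjoin R u"
proof (induction n)
  case 0
  then show ?case using assms by simp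
next
  case (Suc n)
  then obtain c k where c: "\<forall>i. c i \<in> R" "p * u ^ n = (\<Sum>i<k. c i * u ^ i)"
    by (auto simp: adjoin_def)
  have "p * u ^ Suc n = u * (p * u ^ n)" by (simp add: ac_simps)
  also have "\<dots> = (\<Sum>i<Suc k. (case i of 0 \<Rightarrow> 0 | Suc j \<Rightarrow> c j) * u ^ i)"
    by (subst sum.lessThan_Suc_shift) (simp add: c(2) sum_distrib_left ac_simps)
  also have "\<dots> \<in> adjoin R u"
    using R c(1) by (intro adjoinI) (auto intro: subring_closed split: nat.splits)
  finally show ?case .
qed

lemma subring_adjoin:
  assumes R: "subring R"
  shows "subring (adjoin R u)"
proof -
  have sum: "sum f {..<k} \<in> adjoin R u" if "\<And>i. f i \<in> adjoin R u" for f and k :: nat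
    using that by (induction k) (auto intro: adjoin_add adjoin_base R subring_closed)
  have mult: "p * q \<in> adjoin R u" if p: "p \<in> adjoin R u" and q: "q \<in> adjoin R u" for p q
  proof -
    obtain c k where c: "\<forall>i. c i \<in> R" "p = (\<Sum>i<k. c i * u ^ i)"
      using p by (auto simp: adjoin_def)
    \<comment> \<open>Only \<open>p\<close> is expanded; the multiples \<open>q * u ^ i\<close> are
      already known to lie in \<open>R[u]\<close>, which avoids a convolution of
      coefficients.\<close>
    have "p * q = (\<Sum>i<k. c i * (q * u ^ i))"
      by (simp add: c(2) sum_distrib_left ac_simps)
    also have "\<dots> \<in> adjoin R u"
      using c(1) by (intro sum adjoin_smult adjoin_shift R q) auto
    finally show ?thesis .
  qed
  have "p - q \<in> adjoin R u" if "p \<in> adjoin R u" "q \<in> adjoin R u" for p q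
    using adjoin_add[OF R that(1) adjoin_smult[OF R _ that(2), of "-1"]]
    by (simp add: subring_closed R)
  then show ?thesis
    using mult by (auto simp: subring_def intro: adjoin_base R subring_closed)
qed

section \<open>Leading coefficients and the chain condition for \<open>R[u]\<close>\<close>

text \<open>
  The leading coefficients are those of expressions in \<open>u\<close>, not of polynomials: \<open>u\<close> may be algebraic
  over \<open>R\<close>, and an element of \<open>J\<close> may contribute several leading coefficients.
\<close>

definition lead_coeffs :: "'a::comm_ring_1 set \<Rightarrow> 'a \<Rightarrow> 'a set \<Rightarrow> nat \<Rightarrow> 'a set" where
  "lead_coeffs R u J k = {c k | c. (\<forall>i. c i \<in> R) \<and> (\<Sum>i\<le>k. c i * u ^ i) \<in> J}"

text \<open>The coefficient in position \<open>k\<close> is allowed to vanish, so cancellation in a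
  sum of two expressions needs no separate case.\<close>

lemma ideal_of_lead_coeffs:
  assumes R: "subring R" and J: "ideal_of (adjoin R u) J"
  shows "ideal_of R (lead_coeffs R u J k)"
proof -
  have "0 \<in> lead_coeffs R u J k"
    using ideal_of_closed(2)[OF J] subring_closed(1)[OF R]
    by (auto simp: lead_coeffs_def intro!: exI[of _ "\<lambda>_. 0"])
  moreover have "a + b \<in> lead_coeffs R u J k"
    if "a \<in> lead_coeffs R u J k" "b \<in> lead_coeffs R u J k" for a b
  proof -
    obtain c d where c: "\<forall>i. c i \<in> R" "(\<Sum>i\<le>k. c i * u ^ i) \<in> J" "a = c k"
      and d: "\<forall>i. d i \<in> R" "(\<Sum>i\<le>k. d i * u ^ i) \<in> J" "b = d k"
      using \<open>a \<in> _\<close> \<open>b \<in> _\<close> by (auto simp: lead_coeffs_def)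
    have "(\<Sum>i\<le>k. (c i + d i) * u ^ i) \<in> J"
      using ideal_of_closed(3)[OF J c(2) d(2)] by (simp add: sum.distrib distrib_right)
    with c d show ?thesis
      by (auto simp: lead_coeffs_def intro!: exI[of _ "\<lambda>i. c i + d i"] subring_closed[OF R])
  qed
  moreover have "r * a \<in> lead_coeffs R u J k"
    if "r \<in> R" "a \<in> lead_coeffs R u J k" for r a
  proof -
    obtain c where c: "\<forall>i. c i \<in> R" "(\<Sum>i\<le>k. c i * u ^ i) \<in> J" "a = c k"
      using \<open>a \<in> _\<close> by (auto simp: lead_coeffs_def)
    have "(\<Sum>i\<le>k. (r * c i) * u ^ i) \<in> J"
      using ideal_of_closed(4)[OF J adjoin_base[OF R \<open>r \<in> R\<close>] c(2)]
      by (simp add: sum_distrib_left mult.assoc)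
    with c \<open>r \<in> R\<close> show ?thesis
      by (auto simp: lead_coeffs_def intro!: exI[of _ "\<lambda>i. r * c i"] subring_closed[OF R])
  qed
  ultimately show ?thesis by (auto simp: ideal_of_def) (auto simp: lead_coeffs_def)
qed

text \<open>Multiplication by \<open>u\<close> keeps an element in \<open>J\<close> and shifts its
  coefficients up by one.\<close>

lemma lead_coeffs_Suc:
  assumes R: "subring R" and J: "ideal_of (adjoin R u) J"
  shows "lead_coeffs R u J k \<subseteq> lead_coeffs R u J (Suc k)"
proof
  fix a assume "a \<in> lead_coeffs R u J k"
  then obtain c where c: "\<forall>i. c i \<in> R" "(\<Sum>i\<le>k. c i * u ^ i) \<in> J" "a = c k"
    by (auto simp: lead_coeffs_def)
  define d where "d i = (case i of 0 \<Rightarrow> 0 | Suc j \<Rightarrow> c j)" for i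
  have "(\<Sum>i\<le>Suc k. d i * u ^ i) = u * (\<Sum>i\<le>k. c i * u ^ i)"
    by (subst sum.atMost_Suc_shift) (simp add: d_def sum_distrib_left ac_simps)
  also have "\<dots> \<in> J" using ideal_of_closed(4)[OF J adjoin_gen[OF R] c(2)] .
  finally show "a \<in> lead_coeffs R u J (Suc k)"
    using c by (auto simp: lead_coeffs_def d_def intro!: exI[of _ d] subring_closed[OF R]
        split: nat.splits)
qed

lemma lead_coeffs_mono: "J \<subseteq> J' \<Longrightarrow> lead_coeffs R u J k \<subseteq> lead_coeffs R u J' k"
  by (auto simp: lead_coeffs_def)

text \<open>Descent on the length of an expression: subtracting an element of \<open>J\<close> with
  the same top coefficient leaves a shorter expression that is still in \<open>J'\<close>.\<close>

lemma subset_if_lead_coeffs_subset: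
  assumes R: "subring R" and J: "ideal_of (adjoin R u) J" and J': "ideal_of (adjoin R u) J'"
    and "J \<subseteq> J'" and lead: "\<And>k. lead_coeffs R u J' k \<subseteq> lead_coeffs R u J k"
  shows "J' \<subseteq> J"
proof -
  have "(\<Sum>i<k. c i * u ^ i) \<in> J" if "\<forall>i. c i \<in> R" "(\<Sum>i<k. c i * u ^ i) \<in> J'" for c k
    using that
  proof (induction k arbitrary: c)
    case 0
    then show ?case using ideal_of_closed(2)[OF J] by simp
  next
    case (Suc k)
    have "c k \<in> lead_coeffs R u J' k"
      using Suc.prems by (auto simp: lead_coeffs_def lessThan_Suc_atMost)
    then have "c k \<in> lead_coeffs R u J k" using lead by blast
    then obtain d where d: "\<forall>i. d i \<in> R" "(\<Sum>i<Suc k. d i * u ^ i) \<in> J" "c k = d k"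
      by (auto simp: lead_coeffs_def lessThan_Suc_atMost)
    have eq: "(\<Sum>i<Suc k. c i * u ^ i) - (\<Sum>i<Suc k. d i * u ^ i) = (\<Sum>i<k. (c i - d i) * u ^ i)"
      by (simp add: d(3) sum_subtractf left_diff_distrib)
    have "(\<Sum>i<k. (c i - d i) * u ^ i) \<in> J'"
      unfolding eq[symmetric]
      using Suc.prems(2) d(2) \<open>J \<subseteq> J'\<close>
      by (intro ideal_of_diff[OF subring_adjoin[OF R] J']) auto
    then have "(\<Sum>i<k. (c i - d i) * u ^ i) \<in> J"
      using Suc.prems(1) d(1) by (intro Suc.IH) (auto intro: subring_closed[OF R])
    then have "(\<Sum>i<k. (c i - d i) * u ^ i) + (\<Sum>i<Suc k. d i * u ^ i) \<in> J"
      using d(2) by (intro ideal_of_closed(3)[OF J])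
    then show ?case by (simp add: eq[symmetric] del: sum.lessThan_Suc)
  qed
  moreover have "\<exists>c k. (\<forall>i. c i \<in> R) \<and> p = (\<Sum>i<k. c i * u ^ i)" if "p \<in> J'" for p
    using ideal_of_closed(1)[OF J' that] by (auto simp: adjoin_def)
  ultimately show ?thesis by blast
qed

text \<open>The ideals \<open>L i k\<close> increase in both indices. Stabilization of the diagonal
  controls all \<open>k\<close> from some \<open>M\<close> on, and the finitely many
  \<open>k\<close> below \<open>M\<close> are treated one at a time.\<close>

theorem noetherian_adjoin:
  assumes noeth: "noetherian R"
  shows "noetherian (adjoin R u)"
proof -
  have R: "subring R" using noeth by (rule noetherian_subring)
  have "\<exists>N. \<forall>i\<ge>N. J i = J N"
    if J: "\<And>i. ideal_of (adjoin R u) (J i)" and mono: "mono J" for J :: "nat \<Rightarrow> 'a set"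
  proof -
    define L where "L i k = lead_coeffs R u (J i) k" for i k
    have L_ideal: "ideal_of R (L i k)" for i k
      unfolding L_def by (intro ideal_of_lead_coeffs R J)
    have mono2: "L i k \<subseteq> L i l" if "k \<le> l" for i k l
      using that unfolding L_def
      by (rule lift_Suc_mono_le[of "\<lambda>k. lead_coeffs R u (J i) k", rotated])
        (intro lead_coeffs_Suc R J)
    have mono1: "L i k \<subseteq> L j k" if "i \<le> j" for i j k
      using monoD[OF mono that] unfolding L_def by (rule lead_coeffs_mono)
    have "mono (\<lambda>i. L i i)"
      by (rule monoI) (use mono1 mono2 in blast)
    then obtain M where M: "\<And>i. i \<ge> M \<Longrightarrow> L i i = L M M"
      using noetherian_chain[OF noeth, of "\<lambda>i. L i i"] L_ideal by blast
    have "\<exists>N. \<forall>i\<ge>N. L i k = L N k" for k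
      using noetherian_chain[OF noeth, of "\<lambda>i. L i k"] L_ideal mono1
      by (metis (no_types, lifting) monoI)
    then obtain n where n: "\<And>k i. i \<ge> n k \<Longrightarrow> L i k = L (n k) k" by metis
    \<comment> \<open>A bound for the diagonal and for every \<open>k < M\<close> at once; inserting
      \<open>M\<close> also keeps the set nonempty when \<open>M\<close> is 0.\<close>
    define N where "N = Max (insert M (n ` {..<M}))"
    have "M \<le> N" by (simp add: N_def)
    have "L i k \<subseteq> L N k" if "i \<ge> N" for i k
    proof (cases "k < M")
      case True
      then have "n k \<le> N" by (simp add: N_def)
      with n[of k i] n[of k N] that show ?thesis by simp
    next
      case False
      \<comment> \<open>Both \<open>L i k\<close> and \<open>L N k\<close> are compared with the
        stable diagonal value: the first lies below a diagonal entry of index at least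
        \<open>M\<close>, the second above \<open>L M M\<close>.\<close>
      have "L i k \<subseteq> L (max i k) (max i k)" using mono1 mono2 by (meson dual_order.trans max.cobounded1 max.cobounded2)
      also have "\<dots> = L M M" using False by (intro M) simp
      also have "\<dots> \<subseteq> L N k" using False \<open>M \<le> N\<close> mono1 mono2 by (meson dual_order.trans linorder_not_less)
      finally show ?thesis .
    qed
    then have "J i = J N" if "i \<ge> N" for i
      using that monoD[OF mono that] subset_if_lead_coeffs_subset[OF R J J, of N i]
      unfolding L_def by blast
    then show ?thesis by blast
  qed
  then show ?thesis by (auto simp: noetherian_def intro: subring_adjoin R)
qed

section \<open>Adjoining finitely many elements\<close>

text \<open>The last clause identifies \<open>R'\<close> as the subring generated by
  \<open>R\<close> and \<open>X\<close>; it will keep the ring built from generators inside the Rees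
  ring.\<close>

lemma noetherian_adjoin_finite:
  assumes noeth: "noetherian R" and "finite X"
  obtains R' where "noetherian R'" "R \<subseteq> R'" "X \<subseteq> R'"
    and "\<And>Q. subring Q \<Longrightarrow> R \<subseteq> Q \<Longrightarrow> X \<subseteq> Q \<Longrightarrow> R' \<subseteq> Q"
proof -
  have "\<exists>R'. noetherian R' \<and> R \<subseteq> R' \<and> X \<subseteq> R' \<and>
      (\<forall>Q. subring Q \<longrightarrow> R \<subseteq> Q \<longrightarrow> X \<subseteq> Q \<longrightarrow> R' \<subseteq> Q)"
    using \<open>finite X\<close>
  proof induction
    case empty
    then show ?case using noeth by blast
  next
    case (insert u X)
    then obtain R' where R': "noetherian R'" "R \<subseteq> R'" "X \<subseteq> R'"
      and least: "\<And>Q. subring Q \<Longrightarrow> R \<subseteq> Q \<Longrightarrow> X \<subseteq> Q \<Longrightarrow> R' \<subseteq> Q" by blast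
    have "R' \<subseteq> adjoin R' u" "u \<in> adjoin R' u"
      using noetherian_subring[OF R'(1)] by (auto intro: adjoin_base adjoin_gen)
    moreover have "adjoin R' u \<subseteq> Q" if Q: "subring Q" "R \<subseteq> Q" "insert u X \<subseteq> Q" for Q
    proof -
      have "R' \<subseteq> Q" using least Q by blast
      then show ?thesis
        using Q by (auto simp: adjoin_def intro!: subring_sum subring_closed(4) subring_power)
    qed
    ultimately show ?case
      using noetherian_adjoin[OF R'(1), of u] R'(2,3)
      by (intro exI[of _ "adjoin R' u"]) blast
  qed
  then show thesis using that by blast
qed

section \<open>Polynomial rings over a field\<close>

text \<open>This puts every term into any subring that contains the constants and the
  variables.\<close>

lemma single_eq_const_times_vars:
  "Poly_Mapping.single m c =
     Poly_Mapping.single 0 c * (\<Prod>i\<in>UNIV. (var i :: ('n::finite, 'k::comm_ring_1) mpoly) ^ Poly_Mapping.lookup m i)"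
proof -
  have pow: "(var i :: ('n, 'k) mpoly) ^ e = Poly_Mapping.single (Poly_Mapping.single i e) 1" for i e
    by (induction e) (simp_all add: var_def mult_single flip: single_one single_add)
  have prod: "(\<Prod>i\<in>A. Poly_Mapping.single (g i) 1) = (Poly_Mapping.single (\<Sum>i\<in>A. g i) 1 :: ('n, 'k) mpoly)"
    if "finite A" for A :: "'n set" and g
    using that by (induction A) (simp_all add: mult_single flip: single_one)
  have "m = (\<Sum>i\<in>UNIV. Poly_Mapping.single i (Poly_Mapping.lookup m i))"
    by (rule poly_mapping_eqI) (simp add: lookup_sum lookup_single when_def)
  then show ?thesis
    by (simp add: pow prod mult_single)
qed

lemma noetherian_mpoly: "noetherian (UNIV :: ('n::finite, 'k::field) mpoly set)"
proof -
  define \<phi> :: "'k \<Rightarrow> ('n, 'k) mpoly" where "\<phi> = Poly_Mapping.single 0"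
  have "noetherian (range \<phi>)"
    by (intro noetherian_image noetherian_field) (simp_all add: \<phi>_def single_add mult_single)
  then obtain R :: "('n, 'k) mpoly set" where R: "noetherian R" "range \<phi> \<subseteq> R" "range var \<subseteq> R"
    using noetherian_adjoin_finite[of "range \<phi>" "range var"] by (metis finite finite_imageI)
  note sub = noetherian_subring[OF R(1)]
  have "f \<in> R" for f
  proof -
    have "f = (\<Sum>m\<in>Poly_Mapping.keys f. Poly_Mapping.single m (Poly_Mapping.lookup f m))"
      by (rule poly_mapping_eqI) (auto simp: lookup_sum lookup_single when_def in_keys_iff)
    also have "\<dots> \<in> R"
    proof (rule subring_sum[OF sub])
      fix m
      show "Poly_Mapping.single m (Poly_Mapping.lookup f m) \<in> R"
        using R(2,3)
        by (subst single_eq_const_times_vars,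
            intro subring_closed(4)[OF sub] subring_prod[OF sub] subring_power[OF sub])
          (auto simp: \<phi>_def)
    qed
    finally show ?thesis .
  qed
  then have "R = UNIV" by blast
  with R(1) show ?thesis by simp
qed

section \<open>Ideals and their powers\<close>

context
begin

interpretation module_self: module "(*) :: 'a::comm_ring_1 \<Rightarrow> 'a \<Rightarrow> 'a"
  by (rule module_times)

text \<open>The bridge between submodules of the ring and the ideals in the chain condition.\<close>

lemma is_ideal_iff: "is_ideal J \<longleftrightarrow> ideal_of UNIV J"
  by (auto simp: ideal_of_def module_self.subspace_def)

lemma is_ideal_closed:
  assumes "is_ideal J"
  shows "0 \<in> J" "a \<in> J \<Longrightarrow> b \<in> J \<Longrightarrow> a + b \<in> J" "a \<in> J \<Longrightarrow> r * a \<in> J" "a \<in> J \<Longrightarrow> a * r \<in> J"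
  using assms by (auto simp: module_self.subspace_def mult.commute[of a r])

lemma is_ideal_gen: "is_ideal (ideal_gen X)"
  by (rule module_self.subspace_span)

lemma ideal_gen_least: "X \<subseteq> J \<Longrightarrow> is_ideal J \<Longrightarrow> ideal_gen X \<subseteq> J"
  by (rule module_self.span_minimal)

lemma ideal_gen_superset: "X \<subseteq> ideal_gen X"
  by (rule module_self.span_superset)

lemma ideal_gen_mono: "X \<subseteq> Y \<Longrightarrow> ideal_gen X \<subseteq> ideal_gen Y"
  by (rule module_self.span_mono)

end

text \<open>Inclusions of the form "\<open>x\<close> times an ideal power lies in \<open>J\<close>"
  can thus be checked on generators of the power.\<close>

lemma is_ideal_multiplier:
  assumes "is_ideal J"
  shows "is_ideal {z. x * z \<in> J}"
  using assms by (auto simp: is_ideal_iff ideal_of_def distrib_left mult.left_commute)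

text \<open>Otherwise each finite subset of \<open>I\<close>, starting from the empty one, could be
  enlarged by an element of \<open>I\<close> outside its span, and dependent choice would give a
  strictly ascending chain.\<close>

lemma finitely_generated:
  assumes noeth: "noetherian (UNIV :: 'a::comm_ring_1 set)" and I: "is_ideal (I :: 'a set)"
  shows "\<exists>F. finite F \<and> ideal_gen F = I"
proof (rule ccontr)
  assume "\<not> ?thesis"
  then have neg: "ideal_gen F \<noteq> I" if "finite F" for F using that by blast
  have step: "\<exists>G. (finite G \<and> G \<subseteq> I) \<and> F \<subseteq> G \<and> ideal_gen F \<noteq> ideal_gen G"
    if F: "finite F \<and> F \<subseteq> I" for F
  proof -
    have "ideal_gen F \<subseteq> I" using F I by (intro ideal_gen_least) auto
    moreover have "ideal_gen F \<noteq> I" using F by (intro neg) simp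
    ultimately obtain a where "a \<in> I" "a \<notin> ideal_gen F" by blast
    then show ?thesis
      using F ideal_gen_superset[of "insert a F"] by (intro exI[of _ "insert a F"]) auto
  qed
  obtain F :: "nat \<Rightarrow> 'a set" where F: "\<And>i. F i \<subseteq> F (Suc i)" "\<And>i. ideal_gen (F i) \<noteq> ideal_gen (F (Suc i))"
    using dependent_nat_choice[of "\<lambda>_ F. finite F \<and> F \<subseteq> I" "\<lambda>_ F G. F \<subseteq> G \<and> ideal_gen F \<noteq> ideal_gen G"]
      step by (metis empty_subsetI finite.emptyI)
  have "mono (\<lambda>i. ideal_gen (F i))"
    by (intro mono_iff_le_Suc[THEN iffD2] allI ideal_gen_mono F)
  then obtain N where N: "\<And>i. i \<ge> N \<Longrightarrow> ideal_gen (F i) = ideal_gen (F N)"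
    using noetherian_chain[OF noeth, of "\<lambda>i. ideal_gen (F i)"] is_ideal_gen
    by (auto simp: is_ideal_iff)
  show False using F(2)[of N] N[of "Suc N"] by simp
qed

lemma is_ideal_pow: "is_ideal (ideal_pow I k)"
  by (cases k) (auto simp: ideal_mult_def is_ideal_gen, simp add: is_ideal_iff ideal_of_def)

lemma ideal_pow_SucI: "a \<in> I \<Longrightarrow> b \<in> ideal_pow I k \<Longrightarrow> a * b \<in> ideal_pow I (Suc k)"
  using ideal_gen_superset by (fastforce simp: ideal_mult_def)

lemma ideal_pow_Suc_least:
  assumes "is_ideal J" "\<And>a b. a \<in> I \<Longrightarrow> b \<in> ideal_pow I k \<Longrightarrow> a * b \<in> J"
  shows "ideal_pow I (Suc k) \<subseteq> J"
  unfolding ideal_pow.simps ideal_mult_def using assms by (intro ideal_gen_least) auto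

lemma ideal_pow_antimono: "k \<le> l \<Longrightarrow> ideal_pow I l \<subseteq> ideal_pow I k"
proof (rule lift_Suc_antimono_le[of "ideal_pow I"])
  show "ideal_pow I (Suc n) \<subseteq> ideal_pow I n" for n
    by (intro ideal_pow_Suc_least is_ideal_pow is_ideal_closed(3))
qed

text \<open>Products of elements of the two powers generate the power with exponent
  \<open>a + b\<close>. Peeling off a factor \<open>x\<close> replaces \<open>J\<close> by its
  multiplier ideal for \<open>x\<close>, hence the induction with \<open>J\<close>
  arbitrary.\<close>

lemma ideal_pow_add_least:
  assumes "is_ideal J" "\<And>g h. g \<in> ideal_pow Q a \<Longrightarrow> h \<in> ideal_pow Q b \<Longrightarrow> g * h \<in> J"
  shows "ideal_pow Q (a + b) \<subseteq> J"
  using assms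
proof (induction a arbitrary: J)
  case 0
  from 0(2)[of 1] show ?case by auto
next
  case (Suc a)
  have "x * y \<in> J" if x: "x \<in> Q" and y: "y \<in> ideal_pow Q (a + b)" for x y
  proof -
    have "ideal_pow Q (a + b) \<subseteq> {z. x * z \<in> J}"
    proof (rule Suc.IH[OF is_ideal_multiplier[OF Suc.prems(1)]])
      fix g h assume "g \<in> ideal_pow Q a" "h \<in> ideal_pow Q b"
      with Suc.prems(2)[OF ideal_pow_SucI[OF x], of g h] show "g * h \<in> {z. x * z \<in> J}"
        by (simp add: mult.assoc)
    qed
    with y show ?thesis by blast
  qed
  then show ?case
    unfolding add_Suc by (intro ideal_pow_Suc_least Suc.prems(1))
qed

lemma is_ideal_sum: "is_ideal J \<Longrightarrow> (\<And>i. i \<in> A \<Longrightarrow> f i \<in> J) \<Longrightarrow> sum f A \<in> J"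
  by (induction A rule: infinite_finite_induct) (auto intro: is_ideal_closed)

lemma ideal_pow_mult:
  assumes "a \<in> ideal_pow I i" "b \<in> ideal_pow I j"
  shows "a * b \<in> ideal_pow I (i + j)"
proof -
  have "ideal_pow I i \<subseteq> {z. b * z \<in> ideal_pow I (i + j)}" for i
  proof (induction i)
    case 0
    then show ?case using assms(2) by (auto intro: is_ideal_closed is_ideal_pow)
  next
    case (Suc i)
    show ?case
      using Suc ideal_pow_SucI[of _ I _ "i + j"]
      by (intro ideal_pow_Suc_least is_ideal_multiplier is_ideal_pow)
        (auto simp: mult.left_commute simp del: ideal_pow.simps)
  qed
  with assms(1) show ?thesis by (auto simp: mult.commute)
qed

section \<open>The Rees ring\<close>

text \<open>The polynomial variable plays the role of t, so the Rees ring sits inside S[t].\<close>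

definition rees :: "'a::comm_ring_1 set \<Rightarrow> 'a poly set" where
  "rees I = {p. \<forall>k. coeff p k \<in> ideal_pow I k}"

lemma monom_in_rees: "g \<in> ideal_pow I k \<Longrightarrow> monom g k \<in> rees I"
  by (auto simp: rees_def intro: is_ideal_closed(1) is_ideal_pow)

lemma subring_rees: "subring (rees I)"
proof -
  have "p - q \<in> rees I" if "p \<in> rees I" "q \<in> rees I" for p q
    using that ideal_of_diff[of UNIV "ideal_pow I _"] is_ideal_pow[of I]
    by (auto simp: rees_def is_ideal_iff subring_def)
  moreover have "p * q \<in> rees I" if "p \<in> rees I" "q \<in> rees I" for p q
  proof -
    have "coeff p i * coeff q (k - i) \<in> ideal_pow I k" if "i \<in> {..k}" for i k
      using that \<open>p \<in> _\<close> \<open>q \<in> _\<close> ideal_pow_mult[of "coeff p i" I i "coeff q (k - i)" "k - i"]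
      by (simp add: rees_def)
    then show ?thesis
      unfolding rees_def by (auto simp: coeff_mult intro!: is_ideal_sum is_ideal_pow)
  qed
  moreover have "1 \<in> rees I"
    using monom_in_rees[of 1 I 0] by simp
  ultimately show ?thesis by (auto simp: subring_def)
qed

text \<open>The constants and the monomials \<open>monom f 1\<close>, for \<open>f\<close> in a
  finite generating set of \<open>I\<close>, generate a Noetherian ring \<open>R\<close>. Minimality
  of \<open>R\<close> gives one inclusion; the other holds monomial by monomial.\<close>

lemma noetherian_rees:
  assumes noeth: "noetherian (UNIV :: 'a::comm_ring_1 set)" and I: "is_ideal (I :: 'a set)"
  shows "noetherian (rees I)"
proof -
  obtain F where F: "finite F" "ideal_gen F = I"
    using finitely_generated[OF noeth I] by blast
  have FI: "F \<subseteq> I" using ideal_gen_superset F(2) by blast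
  have "noetherian (range (\<lambda>c :: 'a. [:c:]))"
    by (intro noetherian_image noeth) (simp_all add: one_pCons)
  then obtain R where R: "noetherian R" "range (\<lambda>c. [:c:]) \<subseteq> R" "(\<lambda>f. monom f 1) ` F \<subseteq> R"
    and least: "\<And>Q. subring Q \<Longrightarrow> range (\<lambda>c. [:c:]) \<subseteq> Q \<Longrightarrow> (\<lambda>f. monom f 1) ` F \<subseteq> Q \<Longrightarrow> R \<subseteq> Q"
    using noetherian_adjoin_finite[of _ "(\<lambda>f. monom f 1) ` F"] F(1) by (metis finite_imageI)
  note sub = noetherian_subring[OF R(1)]
  have "R \<subseteq> rees I"
  proof (rule least[OF subring_rees])
    have "[:c:] \<in> rees I" for c using monom_in_rees[of c I 0] by (simp add: monom_0)
    then show "range (\<lambda>c. [:c:]) \<subseteq> rees I" by blast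
    have "monom f 1 \<in> rees I" if "f \<in> F" for f
      using that FI ideal_pow_SucI[of f I 1 0] monom_in_rees[of f I 1] by auto
    then show "(\<lambda>f. monom f 1) ` F \<subseteq> rees I" by blast
  qed
  moreover have "rees I \<subseteq> R"
  proof
    \<comment> \<open>Since \<open>R\<close> contains the constants, the coefficients occurring in
      degree \<open>k\<close> form an ideal, so it suffices to test generators of the powers of
      \<open>I\<close>.\<close>
    have ideal: "is_ideal {a. monom a k \<in> R}" for k
    proof -
      have "monom (r * a) k \<in> R" if "monom a k \<in> R" for r a
        using subring_closed(4)[OF sub _ that, of "[:r:]"] R(2) by (auto simp: smult_monom)
      then show ?thesis
        using subring_closed[OF sub] by (auto simp: is_ideal_iff ideal_of_def simp flip: add_monom)
    qed
    have I_sub: "I \<subseteq> {a. monom a 1 \<in> R}"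
      unfolding F(2)[symmetric] using R(3) by (intro ideal_gen_least ideal) auto
    have pow: "ideal_pow I k \<subseteq> {a. monom a k \<in> R}" for k
    proof (induction k)
      case 0
      then show ?case using R(2) by (auto simp: monom_0)
    next
      case (Suc k)
      show ?case
      proof (intro ideal_pow_Suc_least ideal CollectI)
        fix a b assume "a \<in> I" "b \<in> ideal_pow I k"
        with Suc I_sub have "monom a 1 * monom b k \<in> R"
          by (intro subring_closed(4)[OF sub]) auto
        then show "monom (a * b) (Suc k) \<in> R" by (simp add: mult_monom)
      qed
    qed
    fix p assume "p \<in> rees I"
    then have "(\<Sum>k\<le>degree p. monom (coeff p k) k) \<in> R"
      using pow by (intro subring_sum[OF sub]) (auto simp: rees_def)
    then show "p \<in> R" by (simp add: poly_as_sum_of_monoms)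
  qed
  ultimately show ?thesis using R(1) by simp
qed

section \<open>Saturation of powers\<close>

text \<open>The point is that \<open>N\<close> depends on neither \<open>j\<close> nor
  \<open>M\<close>: one chain in the Rees ring handles all powers of \<open>I\<close>
  together.\<close>

lemma uniform_multiplier_exponent:
  assumes noeth: "noetherian (UNIV :: 'a::comm_ring_1 set)" and I: "is_ideal (I :: 'a set)"
  obtains N where "\<And>j M f. f \<in> ideal_pow I j \<Longrightarrow> f \<in> colon (ideal_pow I (Suc j)) (ideal_pow Q M)
      \<Longrightarrow> f \<in> colon (ideal_pow I (Suc j)) (ideal_pow Q N)"
proof -
  define G where "G N = {p \<in> rees I. \<forall>k. coeff p k \<in> colon (ideal_pow I (Suc k)) (ideal_pow Q N)}" for N
  have "mono G"
    using ideal_pow_antimono[of _ _ Q] unfolding G_def mono_def colon_def by blast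
  moreover have "ideal_of (rees I) (G N)" for N
  proof -
    note sub = subring_rees[of I] and pow = is_ideal_pow[of I]
    have "r * p \<in> G N" if r: "r \<in> rees I" and p: "p \<in> G N" for r p
    proof -
      have "coeff (r * p) k * h \<in> ideal_pow I (Suc k)" if h: "h \<in> ideal_pow Q N" for k h
        unfolding coeff_mult sum_distrib_right
      proof (intro is_ideal_sum pow)
        fix i assume i: "i \<in> {..k}"
        have "coeff p (k - i) * h \<in> ideal_pow I (Suc (k - i))"
          using p h by (auto simp: G_def colon_def)
        moreover have "coeff r i \<in> ideal_pow I i" using r by (simp add: rees_def)
        \<comment> \<open>The extra power of \<open>I\<close> gained by \<open>p\<close> survives:
          \<open>i + Suc (k - i)\<close> is \<open>Suc k\<close> because \<open>i\<close> is at most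
          \<open>k\<close>.\<close>
        ultimately have "coeff r i * (coeff p (k - i) * h) \<in> ideal_pow I (i + Suc (k - i))"
          by (intro ideal_pow_mult)
        then show "coeff r i * coeff p (k - i) * h \<in> ideal_pow I (Suc k)"
          using i by (simp add: mult.assoc del: ideal_pow.simps)
      qed
      then show ?thesis
        using r p subring_closed(4)[OF sub] by (auto simp: G_def colon_def)
    qed
    moreover have "p + q \<in> G N" if "p \<in> G N" "q \<in> G N" for p q
      using that subring_closed(6)[OF sub] is_ideal_closed(2)[OF pow]
      by (auto simp: G_def colon_def distrib_right simp del: ideal_pow.simps)
    moreover have "0 \<in> G N"
      using subring_closed(1)[OF sub] is_ideal_closed(1)[OF pow]
      by (auto simp: G_def colon_def simp del: ideal_pow.simps)
    ultimately show ?thesis by (auto simp: ideal_of_def) (auto simp: G_def)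
  qed
  ultimately obtain N where N: "\<And>i. i \<ge> N \<Longrightarrow> G i = G N"
    using noetherian_chain[OF noetherian_rees[OF noeth I], of G] by blast
  show thesis
  proof (rule that)
    fix j M f
    assume f: "f \<in> ideal_pow I j" "f \<in> colon (ideal_pow I (Suc j)) (ideal_pow Q M)"
    \<comment> \<open>As a monomial of degree \<open>j\<close>, \<open>f\<close> has its condition
      in that degree only. Passing through \<open>max M N\<close> covers both \<open>M < N\<close>
      and \<open>M\<close> beyond the stable index.\<close>
    have "monom f j \<in> G M"
      using f monom_in_rees[OF f(1)] is_ideal_closed(1)[OF is_ideal_pow[of I]]
      by (auto simp: G_def colon_def simp del: ideal_pow.simps)
    also have "\<dots> \<subseteq> G (max M N)" using \<open>mono G\<close> by (intro monoD[of G]) auto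
    also have "\<dots> = G N" by (rule N) simp
    finally have "coeff (monom f j) j \<in> colon (ideal_pow I (Suc j)) (ideal_pow Q N)"
      unfolding G_def by blast
    then show "f \<in> colon (ideal_pow I (Suc j)) (ideal_pow Q N)" by simp
  qed
qed

lemma colon_pow_linear:
  assumes noeth: "noetherian (UNIV :: 'a::comm_ring_1 set)" and I: "is_ideal (I :: 'a set)"
  obtains N where "\<And>k M. colon (ideal_pow I k) (ideal_pow Q M) \<subseteq> colon (ideal_pow I k) (ideal_pow Q (N * k))"
proof -
  obtain N where N: "\<And>j M f. f \<in> ideal_pow I j \<Longrightarrow> f \<in> colon (ideal_pow I (Suc j)) (ideal_pow Q M)
      \<Longrightarrow> f \<in> colon (ideal_pow I (Suc j)) (ideal_pow Q N)"
    using uniform_multiplier_exponent[OF noeth I] by blast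
  \<comment> \<open>The induction climbs through \<open>j\<close> up to \<open>k\<close>, adding
    \<open>N\<close> to the exponent at each step; it starts trivially because the zeroth power is
    the whole ring.\<close>
  have "f \<in> colon (ideal_pow I j) (ideal_pow Q (N * j))"
    if f: "f \<in> colon (ideal_pow I k) (ideal_pow Q M)" and "j \<le> k" for f j k M
    using \<open>j \<le> k\<close>
  proof (induction j)
    case 0
    then show ?case by (simp add: colon_def)
  next
    case (Suc j)
    have "ideal_pow Q (N + N * j) \<subseteq> {h. f * h \<in> ideal_pow I (Suc j)}"
    proof (intro ideal_pow_add_least is_ideal_multiplier is_ideal_pow CollectI)
      fix g h assume g: "g \<in> ideal_pow Q N" and h: "h \<in> ideal_pow Q (N * j)"
      \<comment> \<open>The uniform exponent is applied to \<open>f * h\<close>, not to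
        \<open>f\<close>: by induction \<open>f * h\<close> lies in the \<open>j\<close>-th power,
        and multiplying it by the \<open>M\<close>-th power of \<open>Q\<close> lands in the
        \<open>k\<close>-th, hence in the \<open>Suc j\<close>-th power.\<close>
      have "f * h \<in> ideal_pow I j" using Suc h by (auto simp: colon_def)
      moreover have "f * h \<in> colon (ideal_pow I (Suc j)) (ideal_pow Q M)"
      proof -
        have "f * h * z \<in> ideal_pow I (Suc j)" if "z \<in> ideal_pow Q M" for z
        proof -
          have "h * (f * z) \<in> ideal_pow I k"
            using f that by (intro is_ideal_closed(3)[OF is_ideal_pow, of "f * z"]) (simp add: colon_def)
          then show ?thesis
            using ideal_pow_antimono[OF Suc.prems, of I] by (auto simp: ac_simps simp del: ideal_pow.simps)
        qed
        then show ?thesis by (simp add: colon_def del: ideal_pow.simps)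
      qed
      ultimately have "f * h \<in> colon (ideal_pow I (Suc j)) (ideal_pow Q N)" by (rule N)
      with g show "f * (g * h) \<in> ideal_pow I (Suc j)"
        by (auto simp: colon_def ac_simps simp del: ideal_pow.simps)
    qed
    then show ?case by (auto simp: colon_def simp del: ideal_pow.simps)
  qed
  then show thesis using that by blast
qed

theorem corollary1p5:
  fixes I :: "('n::finite, 'k::field) mpoly set"
  assumes "graded_ideal I"
  shows "\<exists>a b :: int. \<forall>k :: nat. int (sat (ideal_pow I k)) \<le> a * int k + b"
proof -
  have I: "is_ideal I" using assms by (simp add: graded_ideal_def)
  obtain N where N: "\<And>k M. colon (ideal_pow I k) (ideal_pow max_ideal M)
      \<subseteq> colon (ideal_pow I k) (ideal_pow max_ideal (N * k))"
    using colon_pow_linear[OF noetherian_mpoly I] by blast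
  have "sat (ideal_pow I k) \<le> N * k" for k
  proof -
    \<comment> \<open>The chain of colons ascends; with the reverse inclusion \<open>N\<close> at
      \<open>M = N * k + 1\<close> it is stationary at \<open>N * k\<close>, which bounds the least
      such index.\<close>
    have "colon (ideal_pow I k) (ideal_pow max_ideal (N * k))
        \<subseteq> colon (ideal_pow I k) (ideal_pow max_ideal (N * k + 1))"
      using ideal_pow_antimono[of "N * k" "N * k + 1" max_ideal]
      by (auto simp: colon_def simp del: ideal_pow.simps)
    then show ?thesis
      unfolding sat_def by (intro Least_le subset_antisym N)
  qed
  \<comment> \<open>The linear bound has slope \<open>N\<close> and intercept 0.\<close>
  then have "int (sat (ideal_pow I k)) \<le> int N * int k + 0" for k
    by (metis add_0_right of_nat_le_iff of_nat_mult)
  then show ?thesis by blast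
qed

end
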